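(* Let $n$ be a non-negative integer and let $s$, $k$, $r$ and $t$ be integers. Each of the following identities holds, provided, in case $r<n$, that the Fibonacci numbers raised to a possibly negative power in that identity are nonzero (namely $F_{k+t}$ and $F_t$ in (1) and (2); $F_{k+t}$ and $F_k$ in (3) and (4); $F_t$ and $F_k$ in (5) and (6)). (1) \[(-1)^t\sum_{j=0}^n\frac{2n+1}{n+j+1}\binom{n+j+1}{2j+1}(F_{k+t}F_t)^{r-j}F_k^{2j+1}F_{r(2s+k)+s-t-(2t+k)j}\] \[=F_{k+t}^{r+n+1}F_t^{r-n}F_{s(r+n+1)+(s+k)(r-n)}-F_t^{r+n+1}F_{k+t}^{r-n}F_{(s+k)(r+n+1)+s(r-n)},\] (2) \[(-1)^t\sum_{j=0}^n\frac{2n+1}{n+j+1}\binom{n+j+1}{2j+1}(F_{k+t}F_t)^{r-j}F_k^{2j+1}L_{r(2s+k)+s-t-(2t+k)j}\] \[=F_{k+t}^{r+n+1}F_t^{r-n}L_{s(r+n+1)+(s+k)(r-n)}-F_t^{r+n+1}F_{k+t}^{r-n}L_{(s+k)(r+n+1)+s(r-n)},\] (3) \[\sum_{j=0}^n(-1)^{tj}\frac{2n+1}{n+j+1}\binom{n+j+1}{2j+1}(F_{k+t}F_k)^{r-j}F_t^{2j+1}F_{r(2s-t)+s+k+(2k+t)j}\] \[=(-1)^{tn}F_{k+t}^{r+n+1}F_k^{r-n}F_{s(2r+1)-t(r-n)}-(-1)^{tn+t}F_k^{r+n+1}F_{k+t}^{r-n}F_{s(2r+1)-t(r+n+1)},\]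 (4) \[\sum_{j=0}^n(-1)^{tj}\frac{2n+1}{n+j+1}\binom{n+j+1}{2j+1}(F_{k+t}F_k)^{r-j}F_t^{2j+1}L_{r(2s-t)+s+k+(2k+t)j}\] \[=(-1)^{tn}F_{k+t}^{r+n+1}F_k^{r-n}L_{s(2r+1)-t(r-n)}-(-1)^{tn+t}F_k^{r+n+1}F_{k+t}^{r-n}L_{s(2r+1)-t(r+n+1)},\] (5) \[\sum_{j=0}^n(-1)^{(t-1)j}\frac{2n+1}{n+j+1}\binom{n+j+1}{2j+1}(F_tF_k)^{r-j}F_{k+t}^{2j+1}F_{s(2r+1)+(k-t)r-(k-t)j}\] \[=(-1)^{(t-1)n}F_t^{r+n+1}F_k^{r-n}F_{s(2r+1)+k(r+n+1)+t(n-r)}-(-1)^{(t-1)(n+1)}F_k^{r+n+1}F_t^{r-n}F_{s(2r+1)-k(n-r)-t(r+n+1)},\] (6) \[\sum_{j=0}^n(-1)^{(t-1)j}\frac{2n+1}{n+j+1}\binom{n+j+1}{2j+1}(F_tF_k)^{r-j}F_{k+t}^{2j+1}L_{s(2r+1)+(k-t)r-(k-t)j}\] \[=(-1)^{(t-1)n}F_t^{r+n+1}F_k^{r-n}L_{s(2r+1)+k(r+n+1)+t(n-r)}-(-1)^{(t-1)(n+1)}F_k^{r+n+1}F_t^{r-n}L_{s(2r+1)-k(n-r)-t(r+n+1)}.\]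
   Context: The Fibonacci numbers $F_n$ and Lucas numbers $L_n$ are defined for all integers $n$ by $F_0=0$, $F_1=1$, $F_n=F_{n-1}+F_{n-2}$ for $n\ge 2$; $L_0=2$, $L_1=1$, $L_n=L_{n-1}+L_{n-2}$ for $n\ge 2$; and $F_{-n}=(-1)^{n-1}F_n$, $L_{-n}=(-1)^nL_n$. Here $F_m^i$ denotes the $i$-th power $(F_m)^i$ (a rational number when $i<0$), with the usual convention $0^0=1$. *)

theory Defs
  imports Complex_Main "HOL-Number_Theory.Fib"
begin

fun lucas :: "nat \<Rightarrow> nat" where
  "lucas 0 = 2"
| "lucas (Suc 0) = 1"
| "lucas (Suc (Suc n)) = lucas (Suc n) + lucas n"

definition fib_int :: "int \<Rightarrow> int" where
  "fib_int m =
     (if m \<ge> 0 then int (fib (nat m))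
      else (-1) ^ (nat (-m) - 1) * int (fib (nat (-m))))"

definition lucas_int :: "int \<Rightarrow> int" where
  "lucas_int m =
     (if m \<ge> 0 then int (lucas (nat m))
      else (-1) ^ nat (-m) * int (lucas (nat (-m))))"

text \<open>
  The identities involve integer powers with possibly negative exponents, so they are
  stated over the rationals.
\<close>

abbreviation F :: "int \<Rightarrow> rat" where
  "F m \<equiv> of_int (fib_int m)"

abbreviation L :: "int \<Rightarrow> rat" where
  "L m \<equiv> of_int (lucas_int m)"

definition coef :: "nat \<Rightarrow> nat \<Rightarrow> rat" where
  "coef n j = of_nat (2 * n + 1) / of_nat (n + j + 1) * of_nat ((n + j + 1) choose (2 * j + 1))"

end

theory Submission
  imports Defs
begin

text \<open>
  All six identities are instances of a single one. For commuting \<open>x\<close> and \<open>y\<close>,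
  \<open>x ^ (2n+1) - y ^ (2n+1) = (\<Sum>j\<le>n. coef n j * (x * y) ^ (n-j) * (x - y) ^ (2j+1))\<close>,
  an odd-index Chebyshev (Dickson) expansion. It is applied to \<open>x = a E\<^sup>p\<close> and \<open>y = b E\<^sup>q\<close>, where
  \<open>E\<close> is the shift operator on two-sided sequences and \<open>a\<close>, \<open>b\<close> are scalars:
  if a sequence \<open>G\<close> satisfies \<open>a E\<^sup>p G - b E\<^sup>q G = c E\<^sup>w G\<close>, then on \<open>G\<close> and its shifts \<open>x - y\<close> may be
  replaced by \<open>c E\<^sup>w\<close>. This is \<open>shift_expansion\<close>; its proof, by induction on \<open>n\<close>, rests on the
  coefficient recurrence \<open>coef_rec\<close>. Multiplying by the, possibly negative, power \<open>(x y) ^ (r-n)\<close>,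
  up to sign, gives \<open>shift_expansion_powi\<close>.

  The three-term relation needed is the d'Ocagne-type identity
  \<open>F (k+t) * G m - F t * G (m+k) = (-1) ^ t * F k * G (m-t)\<close>, valid for every two-sided sequence \<open>G\<close>
  obeying the Fibonacci recurrence (\<open>gibonacci_dOcagne\<close>). Solving it for each of its three
  terms in turn gives the three pairs of identities, and in each pair \<open>G\<close> is \<open>F\<close> or \<open>L\<close>.
\<close>

section \<open>Two-sided sequences with the Fibonacci recurrence\<close>

text \<open>A two-sided sequence satisfying the Fibonacci recurrence, with arbitrary initial values.\<close>

definition gibonacci :: "(int \<Rightarrow> 'a::comm_ring_1) \<Rightarrow> bool" where
  "gibonacci G \<longleftrightarrow> (\<forall>m. G (m + 2) = G (m + 1) + G m)"

lemma gibonacciD: "gibonacci G \<Longrightarrow> G (m + 2) = G (m + 1) + G m"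
  by (simp add: gibonacci_def)

lemma gibonacci_eq_0:
  assumes G: "gibonacci G" and "G 0 = 0" "G 1 = 0"
  shows "G m = 0"
proof -
  have "G m = 0 \<and> G (m + 1) = 0"
  proof (induction m rule: int_induct[where k = 0])
    case base
    show ?case using assms by simp
  next
    case (step1 i)
    then show ?case using gibonacciD[OF G, of i] by (simp add: add.assoc)
  next
    case (step2 i)
    then show ?case using gibonacciD[OF G, of "i - 1"] by (simp add: algebra_simps)
  qed
  then show ?thesis ..
qed

lemma fib_int_nat: "fib_int (int i) = int (fib i)"
  by (simp add: fib_int_def)

lemma fib_int_minus_nat: "fib_int (- int i) = (-1) ^ (i + 1) * int (fib i)"
  by (cases i) (simp_all add: fib_int_def nat_add_distrib del: fib.simps(3))

lemma lucas_int_nat: "lucas_int (int i) = int (lucas i)"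
  by (simp add: lucas_int_def)

lemma lucas_int_minus_nat: "lucas_int (- int i) = (-1) ^ i * int (lucas i)"
  by (cases i) (simp_all add: lucas_int_def nat_add_distrib del: lucas.simps(3))

text \<open>Crossing zero is the only case in which the three indices do not have a common sign.\<close>

lemma gibonacciI:
  assumes nonneg: "\<And>i. G (int (i + 2)) = G (int (i + 1)) + G (int i)"
    and cross: "G 1 = G 0 + G (- 1)"
    and neg: "\<And>i. G (- int i) = G (- int (i + 1)) + G (- int (i + 2))"
  shows "gibonacci G"
  unfolding gibonacci_def
proof
  fix m :: int
  consider i where "m = int i" | "m = - 1" | i where "m = - int (i + 2)"
  proof -
    have "m = int (nat m) \<or> m = - 1 \<or> m = - int (nat (- m - 2) + 2)" by linarith
    then show thesis using that by blast
  qed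
  then show "G (m + 2) = G (m + 1) + G m"
  proof cases
    case 1
    then show ?thesis using nonneg[of "nat m"] by (simp add: algebra_simps)
  next
    case 2
    then show ?thesis using cross by simp
  next
    case (3 i)
    have "m + 2 = - int i" "m + 1 = - int (i + 1)" using 3 by simp_all
    then show ?thesis using neg[of i] 3 by metis
  qed
qed

lemma gibonacci_fib_int: "gibonacci fib_int"
proof (rule gibonacciI)
  show "fib_int 1 = fib_int 0 + fib_int (- 1)" by (simp add: fib_int_def)
qed (unfold fib_int_nat fib_int_minus_nat, simp_all add: algebra_simps)

lemma gibonacci_lucas_int: "gibonacci lucas_int"
proof (rule gibonacciI)
  show "lucas_int 1 = lucas_int 0 + lucas_int (- 1)" by (simp add: lucas_int_def)
qed (unfold lucas_int_nat lucas_int_minus_nat, simp_all add: algebra_simps)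

lemma gibonacci_of_int: "gibonacci G \<Longrightarrow> gibonacci (\<lambda>m. of_int (G m))"
  by (simp add: gibonacci_def)

lemma minus_one_powi_add: "(-1 :: 'a::field) powi (t + 1) = - ((-1) powi t)"
  by (simp add: power_int_add)

text \<open>
  Both sides obey the Fibonacci recurrence in \<open>k\<close>, which leaves the cases \<open>k = 0\<close> and
  \<open>k = 1\<close>; for \<open>k = 1\<close> both sides obey it in \<open>t\<close>.
\<close>

lemma gibonacci_dOcagne:
  fixes G :: "int \<Rightarrow> rat"
  assumes G: "gibonacci G"
  shows "F (k + t) * G m - F t * G (m + k) = (-1) powi t * F k * G (m - t)"
proof -
  note F_rec = gibonacciD[OF gibonacci_of_int[OF gibonacci_fib_int, where 'a = rat]]
  note G_rec = gibonacciD[OF G]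
  have F01: "fib_int 0 = 0" "fib_int 1 = 1" "fib_int 2 = 1"
    by (simp_all add: fib_int_def numeral_2_eq_2)
  let ?f = "\<lambda>t. F (1 + t) * G m - F t * G (m + 1) - (-1) powi t * G (m - t)"
  have "gibonacci ?f"
    unfolding gibonacci_def
  proof
    fix t
    have "F (1 + (t + 2)) = F (1 + (t + 1)) + (F (1 + t) :: rat)"
      using F_rec[of "1 + t"] by (simp add: algebra_simps)
    moreover have "G (m - t) = G (m - (t + 1)) + G (m - (t + 2))"
      using G_rec[of "m - (t + 2)"] by (simp add: algebra_simps)
    moreover have "(-1 :: rat) powi (t + 2) = (-1) powi t"
      by (simp add: power_int_add)
    ultimately show "?f (t + 2) = ?f (t + 1) + ?f t"
      using F_rec[of t] minus_one_powi_add[of t, where 'a = rat] by (simp add: algebra_simps)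
  qed
  moreover have "?f 0 = 0" by (simp add: F01)
  moreover have "?f 1 = 0" using G_rec[of "m - 1"] by (simp add: F01 algebra_simps)
  ultimately have f: "?f t = 0" by (rule gibonacci_eq_0)
  let ?g = "\<lambda>k. F (k + t) * G m - F t * G (m + k) - (-1) powi t * F k * G (m - t)"
  have "gibonacci ?g"
    unfolding gibonacci_def
  proof
    fix k
    have "F (k + 2 + t) = F (k + 1 + t) + (F (k + t) :: rat)"
      using F_rec[of "k + t"] by (simp add: algebra_simps)
    moreover have "G (m + (k + 2)) = G (m + (k + 1)) + G (m + k)"
      using G_rec[of "m + k"] by (simp add: algebra_simps)
    ultimately show "?g (k + 2) = ?g (k + 1) + ?g k"
      using F_rec[of k] by (simp add: algebra_simps)
  qed
  moreover have "?g 0 = 0" by (simp add: F01)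
  moreover have "?g 1 = 0" using f by (simp add: F01)
  ultimately have "?g k = 0" by (rule gibonacci_eq_0)
  then show ?thesis by simp
qed

section \<open>The coefficients\<close>

lemma coef_eq_binomial_sum:
  "coef n j = of_nat ((n + j + 1) choose (2 * j + 1)) + of_nat ((n + j) choose (2 * j + 1))"
proof -
  have "(n + j + 1) * ((n + j) choose (2 * j)) = (2 * j + 1) * ((n + j + 1) choose (2 * j + 1))"
    using Suc_times_binomial[of "2 * j" "n + j"] by simp
  moreover have "(n + j + 1) choose (2 * j + 1) = ((n + j) choose (2 * j)) + ((n + j) choose (2 * j + 1))"
    by simp
  ultimately have "(2 * n + 1) * ((n + j + 1) choose (2 * j + 1)) =
      (n + j + 1) * (((n + j + 1) choose (2 * j + 1)) + ((n + j) choose (2 * j + 1)))"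
    by algebra
  then have "(of_nat (2 * n + 1) * of_nat ((n + j + 1) choose (2 * j + 1)) :: rat) =
      of_nat (n + j + 1) * (of_nat ((n + j + 1) choose (2 * j + 1)) + of_nat ((n + j) choose (2 * j + 1)))"
    by (metis of_nat_add of_nat_mult)
  moreover have "(of_nat (n + j + 1) :: rat) \<noteq> 0"
    using of_nat_neq_0[of "n + j"] by simp
  ultimately show ?thesis
    by (simp add: coef_def divide_simps del: of_nat_add binomial_Suc_Suc)
qed

lemma coef_eq_0: "n < j \<Longrightarrow> coef n j = 0"
  by (simp add: coef_eq_binomial_sum binomial_eq_0)

lemma coef_0_right: "coef n 0 = of_nat (2 * n + 1)"
  by (simp add: coef_eq_binomial_sum)

text \<open>
  This mirrors the recurrence of \<open>x ^ (2n+1) - y ^ (2n+1)\<close> in \<open>n\<close>, whose characteristic polynomial is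
  \<open>(X - x\<^sup>2) (X - y\<^sup>2)\<close>, because \<open>x\<^sup>2 + y\<^sup>2 = (x - y)\<^sup>2 + 2 x y\<close>.
\<close>

lemma coef_rec:
  "coef (n + 2) (Suc j) = coef (n + 1) j + 2 * coef (n + 1) (Suc j) - coef n (Suc j)"
proof -
  \<comment> \<open>Pascal's rule, used twice, gives the second difference of a binomial coefficient in its upper index.\<close>
  have "of_nat ((N + 2) choose (M + 2)) = of_nat (N choose M)
      + 2 * (of_nat ((N + 1) choose (M + 2)) :: rat) - of_nat (N choose (M + 2))" for N M
    by (simp add: numeral_2_eq_2)
  from this[of "n + j + 2" "2 * j + 1"] this[of "n + j + 1" "2 * j + 1"]
  show ?thesis
    by (simp add: coef_eq_binomial_sum numeral_eq_Suc)
qed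

section \<open>The expansion for shift operators\<close>

text \<open>The operator \<open>\<Sum>j\<le>n. coef n j * (d E\<^sup>h) ^ (n-j) * (c E\<^sup>w) ^ (2j+1)\<close> applied to \<open>G\<close>, at position \<open>m\<close>.\<close>

definition shift_sum ::
    "rat \<Rightarrow> int \<Rightarrow> rat \<Rightarrow> int \<Rightarrow> (int \<Rightarrow> rat) \<Rightarrow> nat \<Rightarrow> int \<Rightarrow> rat" where
  "shift_sum d h c w G n m = (\<Sum>j=0..n. coef n j * d ^ (n - j) * c ^ (2 * j + 1)
     * G (m + h * (int n - int j) + w * (2 * int j + 1)))"

lemma shift_sum_rec:
  "shift_sum d h c w G (n + 2) m = c^2 * shift_sum d h c w G (n + 1) (m + 2 * w)
     + 2 * d * shift_sum d h c w G (n + 1) (m + h) - d^2 * shift_sum d h c w G n (m + 2 * h)"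
proof -
  define T where "T n m j = coef n j * d ^ (n - j) * c ^ (2 * j + 1)
     * G (m + h * (int n - int j) + w * (2 * int j + 1))" for n m j
  have S: "shift_sum d h c w G n m = (\<Sum>j\<le>N. T n m j)" if "n \<le> N" for n m N
    unfolding shift_sum_def T_def
    by (rule sum.mono_neutral_left) (use that in \<open>auto simp: coef_eq_0\<close>)
  have T0: "T (n + 2) m 0 = 2 * d * T (n + 1) (m + h) 0 - d^2 * T n (m + 2 * h) 0"
    by (simp add: T_def coef_0_right algebra_simps power2_eq_square)
  have TSuc: "T (n + 2) m (Suc j) = c^2 * T (n + 1) (m + 2 * w) j
      + 2 * d * T (n + 1) (m + h) (Suc j) - d^2 * T n (m + 2 * h) (Suc j)" for j
  proof -
    define g where "g = c ^ (2 * j + 3) * G (m + h * (int n + 1 - int j) + w * (2 * int j + 3))"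
    have 1: "T (n + 2) m (Suc j) = coef (n + 2) (Suc j) * d ^ (n + 1 - j) * g"
      by (simp add: T_def g_def algebra_simps power_add power3_eq_cube)
    have 2: "c^2 * T (n + 1) (m + 2 * w) j = coef (n + 1) j * d ^ (n + 1 - j) * g"
      by (simp add: T_def g_def algebra_simps power_add power2_eq_square power3_eq_cube)
    \<comment> \<open>Where truncated subtraction would spoil the exponent of \<open>d\<close>, the coefficient vanishes.\<close>
    have 3: "d * T (n + 1) (m + h) (Suc j) = coef (n + 1) (Suc j) * d ^ (n + 1 - j) * g"
    proof (cases "j \<le> n")
      case True
      have "d * T (n + 1) (m + h) (Suc j) = coef (n + 1) (Suc j) * (d * d ^ (n - j)) * g"
        by (simp add: T_def g_def algebra_simps power_add power3_eq_cube)
      also have "d * d ^ (n - j) = d ^ (n + 1 - j)" using True by (simp add: Suc_diff_le)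
      finally show ?thesis .
    qed (simp add: T_def coef_eq_0)
    have 4: "d^2 * T n (m + 2 * h) (Suc j) = coef n (Suc j) * d ^ (n + 1 - j) * g"
    proof (cases "Suc j \<le> n")
      case True
      then have "n + 1 - j = 2 + (n - Suc j)" by simp
      have "d^2 * T n (m + 2 * h) (Suc j) = coef n (Suc j) * (d^2 * d ^ (n - Suc j)) * g"
        by (simp add: T_def g_def algebra_simps power_add power3_eq_cube)
      also have "d^2 * d ^ (n - Suc j) = d ^ (n + 1 - j)" using \<open>n + 1 - j = _\<close> by (simp only: power_add)
      finally show ?thesis .
    qed (simp add: T_def coef_eq_0)
    show ?thesis
      unfolding mult.assoc[of 2] 1 2 3 4 coef_rec by (simp add: algebra_simps)
  qed
  have "shift_sum d h c w G (n + 2) m = T (n + 2) m 0 + (\<Sum>j\<le>n + 1. T (n + 2) m (Suc j))"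
    using S[of "n + 2" "n + 2"] sum.atMost_Suc_shift[of "T (n + 2) m" "n + 1"] by simp
  also have "\<dots> = c^2 * (\<Sum>j\<le>n + 1. T (n + 1) (m + 2 * w) j)
      + 2 * d * (T (n + 1) (m + h) 0 + (\<Sum>j\<le>n + 1. T (n + 1) (m + h) (Suc j)))
      - d^2 * (T n (m + 2 * h) 0 + (\<Sum>j\<le>n + 1. T n (m + 2 * h) (Suc j)))"
    unfolding T0 TSuc sum.distrib sum_subtractf by (simp add: sum_distrib_left algebra_simps)
  also have "\<dots> = c^2 * (\<Sum>j\<le>n + 1. T (n + 1) (m + 2 * w) j)
      + 2 * d * (\<Sum>j\<le>n + 2. T (n + 1) (m + h) j) - d^2 * (\<Sum>j\<le>n + 2. T n (m + 2 * h) j)"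
    by (simp only: add_2_eq_Suc' Suc_eq_plus1[of n, symmetric] sum.atMost_Suc_shift)
  finally show ?thesis
    using S[of "n + 1" "n + 1" "m + 2 * w"] S[of "n + 1" "n + 2" "m + h"] S[of n "n + 2" "m + 2 * h"]
    by simp
qed

lemma shift_expansion:
  assumes rel: "\<And>m. a * G (m + p) - b * G (m + q) = c * G (m + w)"
  shows "shift_sum (a * b) (p + q) c w G n m
    = a ^ (2 * n + 1) * G (m + p * (2 * int n + 1)) - b ^ (2 * n + 1) * G (m + q * (2 * int n + 1))"
proof -
  \<comment> \<open>the square of the operator relation\<close>
  have sq: "c^2 * G (m + 2 * w) = a^2 * G (m + 2 * p) - 2 * a * b * G (m + p + q) + b^2 * G (m + 2 * q)" for m
  proof -
    have "c^2 * G (m + 2 * w) = c * (a * G (m + w + p) - b * G (m + w + q))"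
      using rel[of "m + w"] by (simp add: power2_eq_square algebra_simps)
    also have "\<dots> = a * (c * G (m + p + w)) - b * (c * G (m + q + w))"
      by (simp add: algebra_simps)
    also have "\<dots> = a * (a * G (m + p + p) - b * G (m + p + q)) - b * (a * G (m + q + p) - b * G (m + q + q))"
      by (simp only: rel)
    finally show ?thesis by (simp add: power2_eq_square algebra_simps)
  qed
  define U where "U n m = a ^ (2 * n + 1) * G (m + p * (2 * int n + 1))
    - b ^ (2 * n + 1) * G (m + q * (2 * int n + 1))" for n m
  have U_rec: "U (n + 2) m = c^2 * U (n + 1) (m + 2 * w) + 2 * (a * b) * U (n + 1) (m + (p + q))
      - (a * b)^2 * U n (m + 2 * (p + q))" for n m
  proof -
    have "c^2 * U (n + 1) (m + 2 * w)
        = a ^ (2 * n + 3) * (c^2 * G (m + p * (2 * int n + 3) + 2 * w))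
        - b ^ (2 * n + 3) * (c^2 * G (m + q * (2 * int n + 3) + 2 * w))"
      by (simp add: U_def algebra_simps numeral_eq_Suc)
    then show ?thesis
      unfolding sq by (simp add: U_def algebra_simps power_add power2_eq_square power3_eq_cube numeral_eq_Suc)
  qed
  have "shift_sum (a * b) (p + q) c w G n m = U n m"
  proof (induction n arbitrary: m rule: induct_nat_012)
    case 0
    show ?case using rel[of m] by (simp add: shift_sum_def U_def coef_0_right)
  next
    case 1
    have "coef 1 1 = 1" by (simp add: coef_eq_binomial_sum numeral_eq_Suc)
    then have "shift_sum (a * b) (p + q) c w G 1 m
        = c * (c^2 * G (m + w + 2 * w)) + 3 * a * b * (c * G (m + p + q + w))"
      by (simp add: shift_sum_def coef_0_right power2_eq_square power3_eq_cube algebra_simps)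
    also have "\<dots> = a^2 * (c * G (m + 2 * p + w)) + a * b * (c * G (m + p + q + w)) + b^2 * (c * G (m + 2 * q + w))"
      unfolding sq by (simp add: algebra_simps)
    also have "\<dots> = U 1 m"
      unfolding rel[symmetric] by (simp add: U_def algebra_simps power2_eq_square power3_eq_cube)
    finally show ?case by simp
  next
    case (ge2 n)
    then show ?case
      using shift_sum_rec[of "a * b" "p + q" c w G n m] U_rec[of n m] by simp
  qed
  then show ?thesis by (simp add: U_def)
qed

lemma power_int_mult_power:
  fixes x :: "'a::field"
  assumes "i < 0 \<Longrightarrow> x \<noteq> 0"
  shows "x powi i * x ^ k = x powi (i + int k)"
proof -
  show ?thesis
  proof (cases "x = 0 \<and> i + int k = 0")
    case True
    then have "i = 0" "k = 0" using assms by linarith+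
    then show ?thesis by simp
  next
    case False
    then have "x powi (i + int k) = x powi i * x powi int k"
      by (intro power_int_add) auto
    then show ?thesis by simp
  qed
qed

text \<open>
  The expansion multiplied by \<open>(a b) ^ (r-n)\<close> and shifted accordingly. The sign \<open>e\<close> is kept
  separate from \<open>b\<close>, and the factor \<open>e ^ n\<close> is included, so that only nonnegative powers of \<open>e\<close>
  occur. For \<open>r \<ge> n\<close> all exponents are nonnegative, and \<open>a\<close> and \<open>b\<close> may vanish.
\<close>

lemma shift_expansion_powi:
  fixes G :: "int \<Rightarrow> rat"
  assumes rel: "\<And>m. a * G (m + p) - e * b * G (m + q) = c * G (m + w)"
    and e: "e * e = 1"
    and nz: "r < int n \<longrightarrow> a \<noteq> 0 \<and> b \<noteq> 0"
  shows "(\<Sum>j=0..n. e ^ j * coef n j * (a * b) powi (r - int j) * c ^ (2 * j + 1)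
            * G ((p + q) * (r - int j) + w * (2 * int j + 1)))
       = e ^ n * a powi (r + int n + 1) * b powi (r - int n) * G (p * (r + int n + 1) + q * (r - int n))
       - e ^ (n + 1) * b powi (r + int n + 1) * a powi (r - int n) * G (q * (r + int n + 1) + p * (r - int n))"
    (is "?lhs = ?rhs")
proof -
  define z where "z = e ^ n * (a * b) powi (r - int n)"
  let ?m = "(p + q) * (r - int n)"
  have ee: "e ^ (2 * i) = 1" for i
    using e by (simp add: power_mult power2_eq_square)
  have pw: "x powi (r - int n) * x ^ (2 * n + 1) = x powi (r + int n + 1)" if "r < int n \<Longrightarrow> x \<noteq> 0" for x :: rat
    using power_int_mult_power[of "r - int n" x "2 * n + 1"] that by (simp add: algebra_simps)
  have "z * shift_sum (a * (e * b)) (p + q) c w G n ?m = ?lhs"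
    unfolding shift_sum_def sum_distrib_left
  proof (rule sum.cong[OF refl])
    fix j assume "j \<in> {0..n}"
    then have j: "j \<le> n" by simp
    have "n + (n - j) = 2 * (n - j) + j" using j by simp
    then have e_pow: "e ^ n * e ^ (n - j) = e ^ j"
      using ee[of "n - j"] by (metis power_add mult_1)
    have ab_pow: "(a * b) powi (r - int n) * (a * b) ^ (n - j) = (a * b) powi (r - int j)"
      using power_int_mult_power[of "r - int n" "a * b" "n - j"] nz j by (simp add: of_nat_diff)
    have "z * (a * (e * b)) ^ (n - j) = (e ^ n * e ^ (n - j)) * ((a * b) powi (r - int n) * (a * b) ^ (n - j))"
      by (simp only: z_def power_mult_distrib mult_ac)
    then have pows: "z * (a * (e * b)) ^ (n - j) = e ^ j * (a * b) powi (r - int j)"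
      unfolding e_pow ab_pow .
    have index: "?m + (p + q) * (int n - int j) = (p + q) * (r - int j)"
      by (simp add: algebra_simps)
    have "z * (coef n j * (a * (e * b)) ^ (n - j) * c ^ (2 * j + 1) * y)
        = (z * (a * (e * b)) ^ (n - j)) * coef n j * c ^ (2 * j + 1) * y" for y
      by (simp only: mult_ac)
    then have "z * (coef n j * (a * (e * b)) ^ (n - j) * c ^ (2 * j + 1) * y)
        = e ^ j * coef n j * (a * b) powi (r - int j) * c ^ (2 * j + 1) * y" for y
      unfolding pows by (simp only: mult_ac)
    then show "z * (coef n j * (a * (e * b)) ^ (n - j) * c ^ (2 * j + 1)
          * G (?m + (p + q) * (int n - int j) + w * (2 * int j + 1)))
        = e ^ j * coef n j * (a * b) powi (r - int j) * c ^ (2 * j + 1)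
          * G ((p + q) * (r - int j) + w * (2 * int j + 1))"
      unfolding index .
  qed
  moreover have "z * shift_sum (a * (e * b)) (p + q) c w G n ?m = ?rhs"
  proof -
    have "z * a ^ (2 * n + 1) = e ^ n * a powi (r + int n + 1) * b powi (r - int n)"
    proof -
      have "z * a ^ (2 * n + 1) = e ^ n * (a powi (r - int n) * a ^ (2 * n + 1)) * b powi (r - int n)"
        by (simp only: z_def power_int_mult_distrib mult_ac)
      moreover have "a powi (r - int n) * a ^ (2 * n + 1) = a powi (r + int n + 1)"
        using pw nz by simp
      ultimately show ?thesis by (simp only:)
    qed
    moreover have "z * (e * b) ^ (2 * n + 1) = e ^ (n + 1) * b powi (r + int n + 1) * a powi (r - int n)"
    proof -
      have "(e * b) ^ (2 * n + 1) = e * b ^ (2 * n + 1)"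
        using ee[of n] by (simp add: power_mult_distrib)
      then have "z * (e * b) ^ (2 * n + 1)
          = e ^ (n + 1) * (b powi (r - int n) * b ^ (2 * n + 1)) * a powi (r - int n)"
        by (simp only: z_def power_int_mult_distrib power_add[of e] power_one_right mult_ac)
      moreover have "b powi (r - int n) * b ^ (2 * n + 1) = b powi (r + int n + 1)"
        using pw nz by simp
      ultimately show ?thesis by (simp only:)
    qed
    moreover have "?m + p * (2 * int n + 1) = p * (r + int n + 1) + q * (r - int n)"
      "?m + q * (2 * int n + 1) = q * (r + int n + 1) + p * (r - int n)"
      by (simp_all add: algebra_simps)
    ultimately show ?thesis
      by (subst shift_expansion) (use rel in \<open>simp_all add: right_diff_distrib flip: mult.assoc\<close>)
  qed
  ultimately show ?thesis by simp
qed

section \<open>The six identities\<close>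

lemma minus_one_powi_square: "(-1 :: 'a::field) powi t * (-1) powi t = 1"
  by (simp flip: power_int_mult_distrib)

lemma minus_one_powi_mult_nat: "(-1 :: 'a::field) powi (t * int j) = ((-1) powi t) ^ j"
  by (simp add: power_int_mult)

text \<open>The identity \<open>gibonacci_dOcagne\<close> solved for \<open>F k * G (m-t)\<close>, whose sign is kept in \<open>c\<close>:
  \<open>a = F (k+t)\<close>, \<open>b = F t\<close>, \<open>c = (-1) ^ t * F k\<close>.\<close>

lemma gibonacci_expansion_F_k:
  fixes G :: "int \<Rightarrow> rat"
  assumes G: "gibonacci G" and nz: "r < int n \<longrightarrow> F (k + t) \<noteq> 0 \<and> F t \<noteq> 0"
  shows "(-1) powi t * (\<Sum>j=0..n. coef n j * (F (k + t) * F t) powi (r - int j) * F k ^ (2 * j + 1)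
            * G (r * (2 * s + k) + s - t - (2 * t + k) * int j))
        = F (k + t) powi (r + int n + 1) * F t powi (r - int n)
            * G (s * (r + int n + 1) + (s + k) * (r - int n))
          - F t powi (r + int n + 1) * F (k + t) powi (r - int n)
            * G ((s + k) * (r + int n + 1) + s * (r - int n))"
proof -
  have rel: "F (k + t) * G (m + s) - 1 * F t * G (m + (s + k)) = ((-1) powi t * F k) * G (m + (s - t))" for m
    using gibonacci_dOcagne[OF G, of k t "m + s"] by (simp add: algebra_simps)
  have sign: "((-1) powi t * F k) ^ (2 * j + 1) = (-1) powi t * F k ^ (2 * j + 1)" for j
    using minus_one_powi_square[where 'a = rat, of t]
    by (simp add: power_mult_distrib power_mult[of "(-1) powi t"] power2_eq_square)
  have index: "(s + (s + k)) * (r - int j) + (s - t) * (2 * int j + 1)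
      = r * (2 * s + k) + s - t - (2 * t + k) * int j" for j
    by (simp add: algebra_simps)
  show ?thesis
    using shift_expansion_powi[OF rel _ nz] unfolding sign index
    by (simp add: sum_distrib_left mult_ac)
qed

text \<open>The identity \<open>gibonacci_dOcagne\<close> solved for \<open>F t * G (m+k)\<close>: \<open>a = F (k+t)\<close>, \<open>e * b = (-1) ^ t * F k\<close>, \<open>c = F t\<close>.\<close>

lemma gibonacci_expansion_F_t:
  fixes G :: "int \<Rightarrow> rat"
  assumes G: "gibonacci G" and nz: "r < int n \<longrightarrow> F (k + t) \<noteq> 0 \<and> F k \<noteq> 0"
  shows "(\<Sum>j=0..n. (-1) powi (t * int j) * coef n j * (F (k + t) * F k) powi (r - int j) * F t ^ (2 * j + 1)
            * G (r * (2 * s - t) + s + k + (2 * k + t) * int j))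
        = (-1) powi (t * int n) * F (k + t) powi (r + int n + 1) * F k powi (r - int n)
            * G (s * (2 * r + 1) - t * (r - int n))
          - (-1) powi (t * int n + t) * F k powi (r + int n + 1) * F (k + t) powi (r - int n)
            * G (s * (2 * r + 1) - t * (r + int n + 1))"
proof -
  have rel: "F (k + t) * G (m + s) - (-1) powi t * F k * G (m + (s - t)) = F t * G (m + (s + k))" for m
    using gibonacci_dOcagne[OF G, of k t "m + s"] by (simp add: algebra_simps)
  have sign: "(-1 :: rat) powi (t * int n + t) = ((-1) powi t) ^ (n + 1)"
    using minus_one_powi_mult_nat[of t "n + 1", where 'a = rat] by (simp add: algebra_simps)
  have index: "(s + (s - t)) * (r - int j) + (s + k) * (2 * int j + 1)
        = r * (2 * s - t) + s + k + (2 * k + t) * int j"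
      "s * (r + int n + 1) + (s - t) * (r - int n) = s * (2 * r + 1) - t * (r - int n)"
      "(s - t) * (r + int n + 1) + s * (r - int n) = s * (2 * r + 1) - t * (r + int n + 1)" for j
    by (simp_all add: algebra_simps)
  show ?thesis
    using shift_expansion_powi[OF rel minus_one_powi_square nz]
    unfolding sign index minus_one_powi_mult_nat .
qed

text \<open>The identity \<open>gibonacci_dOcagne\<close> solved for \<open>F (k+t) * G m\<close>: \<open>a = F t\<close>, \<open>e * b = (-1) ^ (t-1) * F k\<close>, \<open>c = F (k+t)\<close>.\<close>

lemma gibonacci_expansion_F_add:
  fixes G :: "int \<Rightarrow> rat"
  assumes G: "gibonacci G" and nz: "r < int n \<longrightarrow> F t \<noteq> 0 \<and> F k \<noteq> 0"
  shows "(\<Sum>j=0..n. (-1) powi ((t - 1) * int j) * coef n j * (F t * F k) powi (r - int j) * F (k + t) ^ (2 * j + 1)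
            * G (s * (2 * r + 1) + (k - t) * r - (k - t) * int j))
        = (-1) powi ((t - 1) * int n) * F t powi (r + int n + 1) * F k powi (r - int n)
            * G (s * (2 * r + 1) + k * (r + int n + 1) + t * (int n - r))
          - (-1) powi ((t - 1) * (int n + 1)) * F k powi (r + int n + 1) * F t powi (r - int n)
            * G (s * (2 * r + 1) - k * (int n - r) - t * (r + int n + 1))"
proof -
  have rel: "F t * G (m + (s + k)) - (-1) powi (t - 1) * F k * G (m + (s - t)) = F (k + t) * G (m + s)" for m
    using gibonacci_dOcagne[OF G, of k t "m + s"] minus_one_powi_add[of "t - 1", where 'a = rat]
    by (simp add: algebra_simps)
  have sign: "(-1 :: rat) powi ((t - 1) * (int n + 1)) = ((-1) powi (t - 1)) ^ (n + 1)"
    using minus_one_powi_mult_nat[of "t - 1" "n + 1", where 'a = rat] by (simp add: algebra_simps)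
  have index: "(s + k + (s - t)) * (r - int j) + s * (2 * int j + 1)
        = s * (2 * r + 1) + (k - t) * r - (k - t) * int j"
      "(s + k) * (r + int n + 1) + (s - t) * (r - int n)
        = s * (2 * r + 1) + k * (r + int n + 1) + t * (int n - r)"
      "(s - t) * (r + int n + 1) + (s + k) * (r - int n)
        = s * (2 * r + 1) - k * (int n - r) - t * (r + int n + 1)" for j
    by (simp_all add: algebra_simps)
  show ?thesis
    using shift_expansion_powi[OF rel minus_one_powi_square nz]
    unfolding sign index minus_one_powi_mult_nat .
qed

theorem theorem4:
  fixes n :: nat and s k r t :: int
  shows "((r < int n \<longrightarrow> F (k + t) \<noteq> 0 \<and> F t \<noteq> 0) \<longrightarrow>
        (-1) powi t * (\<Sum>j=0..n. coef n j * (F (k + t) * F t) powi (r - int j) * F k ^ (2 * j + 1)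
            * F (r * (2 * s + k) + s - t - (2 * t + k) * int j))
        = F (k + t) powi (r + int n + 1) * F t powi (r - int n)
            * F (s * (r + int n + 1) + (s + k) * (r - int n))
          - F t powi (r + int n + 1) * F (k + t) powi (r - int n)
            * F ((s + k) * (r + int n + 1) + s * (r - int n)))
     \<and> ((r < int n \<longrightarrow> F (k + t) \<noteq> 0 \<and> F t \<noteq> 0) \<longrightarrow>
        (-1) powi t * (\<Sum>j=0..n. coef n j * (F (k + t) * F t) powi (r - int j) * F k ^ (2 * j + 1)
            * L (r * (2 * s + k) + s - t - (2 * t + k) * int j))
        = F (k + t) powi (r + int n + 1) * F t powi (r - int n)
            * L (s * (r + int n + 1) + (s + k) * (r - int n))
          - F t powi (r + int n + 1) * F (k + t) powi (r - int n)
            * L ((s + k) * (r + int n + 1) + s * (r - int n)))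
     \<and> ((r < int n \<longrightarrow> F (k + t) \<noteq> 0 \<and> F k \<noteq> 0) \<longrightarrow>
        (\<Sum>j=0..n. (-1) powi (t * int j) * coef n j * (F (k + t) * F k) powi (r - int j) * F t ^ (2 * j + 1)
            * F (r * (2 * s - t) + s + k + (2 * k + t) * int j))
        = (-1) powi (t * int n) * F (k + t) powi (r + int n + 1) * F k powi (r - int n)
            * F (s * (2 * r + 1) - t * (r - int n))
          - (-1) powi (t * int n + t) * F k powi (r + int n + 1) * F (k + t) powi (r - int n)
            * F (s * (2 * r + 1) - t * (r + int n + 1)))
     \<and> ((r < int n \<longrightarrow> F (k + t) \<noteq> 0 \<and> F k \<noteq> 0) \<longrightarrow>
        (\<Sum>j=0..n. (-1) powi (t * int j) * coef n j * (F (k + t) * F k) powi (r - int j) * F t ^ (2 * j + 1)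
            * L (r * (2 * s - t) + s + k + (2 * k + t) * int j))
        = (-1) powi (t * int n) * F (k + t) powi (r + int n + 1) * F k powi (r - int n)
            * L (s * (2 * r + 1) - t * (r - int n))
          - (-1) powi (t * int n + t) * F k powi (r + int n + 1) * F (k + t) powi (r - int n)
            * L (s * (2 * r + 1) - t * (r + int n + 1)))
     \<and> ((r < int n \<longrightarrow> F t \<noteq> 0 \<and> F k \<noteq> 0) \<longrightarrow>
        (\<Sum>j=0..n. (-1) powi ((t - 1) * int j) * coef n j * (F t * F k) powi (r - int j) * F (k + t) ^ (2 * j + 1)
            * F (s * (2 * r + 1) + (k - t) * r - (k - t) * int j))
        = (-1) powi ((t - 1) * int n) * F t powi (r + int n + 1) * F k powi (r - int n)
            * F (s * (2 * r + 1) + k * (r + int n + 1) + t * (int n - r))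
          - (-1) powi ((t - 1) * (int n + 1)) * F k powi (r + int n + 1) * F t powi (r - int n)
            * F (s * (2 * r + 1) - k * (int n - r) - t * (r + int n + 1)))
     \<and> ((r < int n \<longrightarrow> F t \<noteq> 0 \<and> F k \<noteq> 0) \<longrightarrow>
        (\<Sum>j=0..n. (-1) powi ((t - 1) * int j) * coef n j * (F t * F k) powi (r - int j) * F (k + t) ^ (2 * j + 1)
            * L (s * (2 * r + 1) + (k - t) * r - (k - t) * int j))
        = (-1) powi ((t - 1) * int n) * F t powi (r + int n + 1) * F k powi (r - int n)
            * L (s * (2 * r + 1) + k * (r + int n + 1) + t * (int n - r))
          - (-1) powi ((t - 1) * (int n + 1)) * F k powi (r + int n + 1) * F t powi (r - int n)
            * L (s * (2 * r + 1) - k * (int n - r) - t * (r + int n + 1)))"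
proof -
  note F = gibonacci_of_int[OF gibonacci_fib_int]
  note L = gibonacci_of_int[OF gibonacci_lucas_int]
  show ?thesis
    by (intro conjI impI; rule gibonacci_expansion_F_k[OF F] gibonacci_expansion_F_k[OF L]
        gibonacci_expansion_F_t[OF F] gibonacci_expansion_F_t[OF L]
        gibonacci_expansion_F_add[OF F] gibonacci_expansion_F_add[OF L]; assumption?; blast)
qed

end
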